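(* Let $n\ge1$, let $H\in\mathbb{R}^{n\times n}$ be symmetric and let $c\in\mathbb{R}^n$. Consider $$(\mathrm{D})\quad \min\left\{\tfrac12 x^THx+\tfrac12 y^THy+c^Tx:\ (x,y)\in\mathbb{R}^n\times\mathbb{R}^n,\ x^Tx+y^Ty\le 1\right\}.$$ Then any second-order stationary point of (D) is a global minimizer of (D). Consequently, (D) has no local non-global minimizer, i.e. every local minimizer of (D) is a global minimizer of (D).
   Context: A feasible point $(x^*,y^* )$ of (D) is a stationary point with KKT multiplier $\lambda^*/2$ if $\lambda^*\ge 0$, $(H+\lambda^*I)x^*+c=0$, $(H+\lambda^*I)y^*=0$ and $\lambda^*(x^{*T}x^*+y^{*T}y^*-1)=0$. A stationary point is a second-order stationary point of (D) if it satisfies the standard second-order necessary optimality condition: if $x^{*T}x^*+y^{*T}y^*<1$, then $H$ is positive semidefinite; if $x^{*T}x^*+y^{*T}y^*=1$, then $u^T(H+\lambda^*I)u+v^T(H+\lambda^*I)v\ge 0$ for all $(u,v)\in\mathbb{R}^n\times\mathbb{R}^n$ with $u^Tx^*+v^Ty^*=0$. *)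

theory Defs
  imports "HOL-Analysis.Analysis"
begin

definition D_objective :: "real^'n^'n \<Rightarrow> real^'n \<Rightarrow> (real^'n) \<times> (real^'n) \<Rightarrow> real" where
  "D_objective H c = (\<lambda>(x, y). 1/2 * (x \<bullet> (H *v x)) + 1/2 * (y \<bullet> (H *v y)) + c \<bullet> x)"

definition D_feasible :: "((real^'n) \<times> (real^'n)) set" where
  "D_feasible = {(x, y). x \<bullet> x + y \<bullet> y \<le> 1}"

(* Symmetry is not part of this predicate; it is a separate standing hypothesis on H. *)
definition pos_semidef :: "real^'n^'n \<Rightarrow> bool" where
  "pos_semidef A \<longleftrightarrow> (\<forall>u. 0 \<le> u \<bullet> (A *v u))"

definition shifted :: "real^'n^'n \<Rightarrow> real \<Rightarrow> real^'n^'n" where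
  "shifted H l = H + l *\<^sub>R mat 1"

(* The KKT multiplier of the constraint is l / 2: the gradient of x \<bullet> x + y \<bullet> y - 1
   is (2 x, 2 y), so stationarity of the Lagrangian reads H x + c + l x = 0 and H y + l y = 0. *)
definition stationary_point ::
    "real^'n^'n \<Rightarrow> real^'n \<Rightarrow> (real^'n) \<times> (real^'n) \<Rightarrow> real \<Rightarrow> bool" where
  "stationary_point H c = (\<lambda>(x, y) l.
     (x, y) \<in> D_feasible \<and> 0 \<le> l \<and>
     shifted H l *v x + c = 0 \<and> shifted H l *v y = 0 \<and>
     l * (x \<bullet> x + y \<bullet> y - 1) = 0)"

definition second_order_stationary_point ::
    "real^'n^'n \<Rightarrow> real^'n \<Rightarrow> (real^'n) \<times> (real^'n) \<Rightarrow> bool" where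
  "second_order_stationary_point H c = (\<lambda>(x, y). \<exists>l.
     stationary_point H c (x, y) l \<and>
     (x \<bullet> x + y \<bullet> y < 1 \<longrightarrow> pos_semidef H) \<and>
     (x \<bullet> x + y \<bullet> y = 1 \<longrightarrow>
        (\<forall>u v. u \<bullet> x + v \<bullet> y = 0 \<longrightarrow>
           0 \<le> u \<bullet> (shifted H l *v u) + v \<bullet> (shifted H l *v v))))"

definition global_minimizer :: "('a \<Rightarrow> real) \<Rightarrow> 'a set \<Rightarrow> 'a \<Rightarrow> bool" where
  "global_minimizer f S z \<longleftrightarrow> z \<in> S \<and> (\<forall>w\<in>S. f z \<le> f w)"

definition local_minimizer :: "('a::metric_space \<Rightarrow> real) \<Rightarrow> 'a set \<Rightarrow> 'a \<Rightarrow> bool" where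
  "local_minimizer f S z \<longleftrightarrow> z \<in> S \<and> (\<exists>e>0. \<forall>w\<in>S \<inter> ball z e. f z \<le> f w)"

end

(*
  Everything rests on the positive semidefiniteness of H + l I.  In the sphere case, for any w the
  lifted vector ((w . y) w, -(w . x) w) is tangent at (x, y), and the second-order condition
  evaluated at it is a nonnegative multiple of w . (H + l I) w.  With H + l I positive semidefinite
  the Lagrangian is convex, so a stationary point is a global minimizer.

  A local minimizer z on the unit sphere satisfies the second-order condition because, for unit
  vectors z and w, the objective changes by (w - z) . (Q + l) (w - z) / 2 exactly.  Taking for w the
  reflection of z along d shows that (Q + l) is nonnegative at every d almost tangent to z, and the
  tangent vectors are limits of such d.
*)
theory Submission
  imports Defs
begin

section \<open>Quadratic functions over the unit ball of an inner product space\<close>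

locale quadratic_function =
  fixes Q :: "'a::real_inner \<Rightarrow> 'a" and b :: 'a
  assumes linear: "linear Q"
    and self_adjoint: "Q u \<bullet> v = u \<bullet> Q v"
begin

text \<open>A pair (x, y) is treated as one vector: with H acting on both components as
  \<open>Q\<close> and \<open>b\<close> equal to (c, 0), this is the objective of (D).\<close>

definition q :: "'a \<Rightarrow> real" where
  "q w = 1/2 * (w \<bullet> Q w) + b \<bullet> w"

text \<open>Taylor expansion without remainder. Self-adjointness merges the two cross terms, so
  \<open>Q z + b\<close> is the gradient at \<open>z\<close>.\<close>

lemma q_expand: "q (z + d) = q z + (Q z + b) \<bullet> d + 1/2 * (d \<bullet> Q d)"
  using self_adjoint[of z d]
  by (simp add: q_def linear_add[OF linear] inner_simps inner_commute algebra_simps)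

lemma q_expand_scale:
  "q (z + t *\<^sub>R d) = q z + t * ((Q z + b) \<bullet> d) + t\<^sup>2 / 2 * (d \<bullet> Q d)"
  by (simp add: q_expand linear_scale[OF linear] inner_simps power2_eq_square)

text \<open>With d = w - z, stationarity and complementarity turn q w - q z into half of d \<bullet>
  (Q d + l d) + l (1 - w \<bullet> w), and both summands are nonnegative on the ball.\<close>

lemma global_minimizer_if_psd:
  assumes z: "z \<bullet> z \<le> 1" and l: "0 \<le> l" and stat: "Q z + b + l *\<^sub>R z = 0"
    and compl: "l * (z \<bullet> z - 1) = 0"
    and psd: "\<And>d. 0 \<le> d \<bullet> (Q d + l *\<^sub>R d)"
  shows "global_minimizer q {w. w \<bullet> w \<le> 1} z"
  unfolding global_minimizer_def
proof (intro conjI ballI)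
  fix w :: 'a
  assume "w \<in> {w. w \<bullet> w \<le> 1}"
  then have "l * (w \<bullet> w) \<le> l * 1"
    using l by (intro mult_left_mono) auto
  moreover have "Q z + b = - (l *\<^sub>R z)"
    using stat by (simp add: eq_neg_iff_add_eq_0)
  then have "q w = q z - l * (z \<bullet> (w - z)) + 1/2 * ((w - z) \<bullet> Q (w - z))"
    using q_expand[of z "w - z"] by simp
  moreover have "(w - z) \<bullet> Q (w - z) \<ge> - l * ((w - z) \<bullet> (w - z))"
    using psd[of "w - z"] by (simp add: inner_right_distrib)
  moreover have "l * ((w - z) \<bullet> (w - z)) + 2 * (l * (z \<bullet> (w - z))) = l * (w \<bullet> w) - l * (z \<bullet> z)"
    by (simp add: inner_simps inner_commute algebra_simps)
  moreover have "l * (z \<bullet> z) = l"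
    using compl by (simp add: right_diff_distrib)
  ultimately show "q z \<le> q w"
    by linarith
qed (use z in simp)

text \<open>Along the ray the change of \<open>q\<close> is t times (Q z + b) \<bullet> d + t/2 (d
  \<bullet> Q d). Dividing by t > 0 and letting t tend to 0 leaves the linear term.\<close>

lemma local_minimizer_feasible_direction:
  assumes min: "local_minimizer q S z"
    and feas: "\<forall>\<^sub>F t in at_right 0. z + t *\<^sub>R d \<in> S"
  shows "0 \<le> (Q z + b) \<bullet> d"
    and "(Q z + b) \<bullet> d = 0 \<Longrightarrow> 0 \<le> d \<bullet> Q d"
proof -
  obtain e where "e > 0" and e: "\<And>w. w \<in> S \<Longrightarrow> w \<in> ball z e \<Longrightarrow> q z \<le> q w"
    using min by (auto simp: local_minimizer_def)
  have "((\<lambda>t. z + t *\<^sub>R d) \<longlongrightarrow> z + 0 *\<^sub>R d) (at_right 0)"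
    by (intro tendsto_intros)
  then have "\<forall>\<^sub>F t in at_right 0. dist (z + t *\<^sub>R d) z < e"
    using \<open>e > 0\<close> by (simp add: tendsto_iff)
  with feas eventually_at_right_less[of "0::real"]
  have ev: "\<forall>\<^sub>F t in at_right 0. 0 < t \<and> q z \<le> q (z + t *\<^sub>R d)"
    by eventually_elim (auto intro!: e simp: dist_commute)
  have "\<forall>\<^sub>F t in at_right 0. 0 \<le> (Q z + b) \<bullet> d + t / 2 * (d \<bullet> Q d)"
    using ev
  proof eventually_elim
    case (elim t)
    then have "0 \<le> t * ((Q z + b) \<bullet> d + t / 2 * (d \<bullet> Q d))"
      by (simp add: q_expand_scale power2_eq_square algebra_simps)
    with elim show ?case
      by (simp add: zero_le_mult_iff)
  qed
  moreover have "((\<lambda>t. (Q z + b) \<bullet> d + t / 2 * (d \<bullet> Q d)) \<longlongrightarrow> (Q z + b) \<bullet> d + 0 / 2 * (d \<bullet> Q d))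
      (at_right 0)"
    by (intro tendsto_intros) auto
  ultimately show "0 \<le> (Q z + b) \<bullet> d"
    using tendsto_lowerbound[where a = 0] by fastforce
  show "0 \<le> d \<bullet> Q d" if "(Q z + b) \<bullet> d = 0"
  proof -
    \<comment> \<open>Without the linear term the change is exactly t^2/2 (d \<bullet> Q d), so a
      single t decides the sign.\<close>
    obtain t where "0 < t" "q z \<le> q (z + t *\<^sub>R d)"
      using eventually_happens[OF ev] by auto
    then show ?thesis
      using that by (simp add: q_expand_scale zero_le_mult_iff)
  qed
qed

lemma local_minimizer_interior:
  assumes min: "local_minimizer q {w. w \<bullet> w \<le> 1} z" and z: "z \<bullet> z < 1"
  shows "Q z + b = 0" and "0 \<le> d \<bullet> Q d"
proof -
  have feas: "\<forall>\<^sub>F t in at_right 0. z + t *\<^sub>R d \<in> {w. w \<bullet> w \<le> 1}" for d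
  proof -
    have "((\<lambda>t. (z + t *\<^sub>R d) \<bullet> (z + t *\<^sub>R d)) \<longlongrightarrow> (z + 0 *\<^sub>R d) \<bullet> (z + 0 *\<^sub>R d)) (at_right 0)"
      by (intro tendsto_intros)
    then have "\<forall>\<^sub>F t in at_right 0. (z + t *\<^sub>R d) \<bullet> (z + t *\<^sub>R d) < 1"
      using z by (intro order_tendstoD) auto
    then show ?thesis
      by eventually_elim simp
  qed
  \<comment> \<open>Every direction is feasible at an interior point, in particular the negative
    gradient.\<close>
  have "0 \<le> (Q z + b) \<bullet> - (Q z + b)"
    by (rule local_minimizer_feasible_direction(1)[OF min feas])
  then show g: "Q z + b = 0"
    by (metis inner_ge_zero inner_eq_zero_iff inner_minus_right neg_0_le_iff_le order_antisym)
  show "0 \<le> d \<bullet> Q d"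
    using local_minimizer_feasible_direction(2)[OF min feas] g by simp
qed

text \<open>Directions with d \<bullet> z < 0 enter the ball, so the gradient is nonnegative on an
  open half-space and must be a nonpositive multiple of \<open>z\<close>.\<close>

lemma local_minimizer_sphere_stationary:
  assumes min: "local_minimizer q {w. w \<bullet> w \<le> 1} z" and z: "z \<bullet> z = 1"
  obtains l where "0 \<le> l" "Q z + b + l *\<^sub>R z = 0"
proof
  \<comment> \<open>The only candidate: it makes the residual \<open>p\<close> below orthogonal to
    \<open>z\<close>.\<close>
  define l where "l = - ((Q z + b) \<bullet> z)"
  have descent: "0 \<le> (Q z + b) \<bullet> d" if d: "d \<bullet> z < 0" for d
  proof (rule local_minimizer_feasible_direction(1)[OF min])
    have "((\<lambda>t. 2 * (d \<bullet> z) + t * (d \<bullet> d)) \<longlongrightarrow> 2 * (d \<bullet> z) + 0 * (d \<bullet> d)) (at_right 0)"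
      by (intro tendsto_intros)
    then have "\<forall>\<^sub>F t in at_right 0. 2 * (d \<bullet> z) + t * (d \<bullet> d) < 0"
      by (rule order_tendstoD(2)) (use d in simp)
    with eventually_at_right_less[of "0::real"]
    show "\<forall>\<^sub>F t in at_right 0. z + t *\<^sub>R d \<in> {w. w \<bullet> w \<le> 1}"
    proof eventually_elim
      case (elim t)
      then have "t * (2 * (d \<bullet> z) + t * (d \<bullet> d)) \<le> 0"
        by (intro mult_nonneg_nonpos) auto
      then show ?case
        using z by (simp add: inner_simps inner_commute algebra_simps)
    qed
  qed
  show "0 \<le> l"
    using descent[of "- z"] z by (simp add: l_def)
  define p where "p = Q z + b + l *\<^sub>R z"
  have pz: "p \<bullet> z = 0"
    using z by (simp add: p_def l_def inner_simps)
  have g: "Q z + b = p - l *\<^sub>R z"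
    by (simp add: p_def)
  \<comment> \<open>The direction -p is merely tangent. Tilting it inward by s z makes it admissible
    and yields p \<bullet> p \<le> s l with s arbitrarily small; the denominator l + 1 in
    \<open>s\<close> covers l = 0.\<close>
  have "p \<bullet> p \<le> 0 + \<epsilon>" if "\<epsilon> > 0" for \<epsilon>
  proof -
    define s where "s = \<epsilon> / (l + 1)"
    have s: "0 < s" "s * l \<le> \<epsilon>"
      using that \<open>0 \<le> l\<close> by (auto simp: s_def field_simps)
    have "0 \<le> (p - l *\<^sub>R z) \<bullet> (- p - s *\<^sub>R z)"
      unfolding g[symmetric] using s pz z by (intro descent) (simp add: inner_simps)
    then show ?thesis
      using s pz z by (simp add: inner_simps inner_commute[of z p] algebra_simps)
  qed
  then have "p \<bullet> p \<le> 0"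
    by (rule field_le_epsilon)
  then show "Q z + b + l *\<^sub>R z = 0"
    unfolding p_def[symmetric] by (meson inner_gt_zero_iff not_less)
qed

text \<open>The ray from \<open>z\<close> along a nonzero tangent vector leaves the ball at once, so
  feasible directions do not suffice; the comparison points must lie on the sphere itself.\<close>

lemma local_minimizer_sphere_second_order:
  assumes min: "local_minimizer q {w. w \<bullet> w \<le> 1} z" and z: "z \<bullet> z = 1"
    and stat: "Q z + b + l *\<^sub>R z = 0" and u: "u \<bullet> z = 0"
  shows "0 \<le> u \<bullet> (Q u + l *\<^sub>R u)"
proof (cases "u = 0")
  case False
  obtain e where "e > 0"
    and e: "\<And>w. w \<bullet> w \<le> 1 \<Longrightarrow> w \<in> ball z e \<Longrightarrow> q z \<le> q w"
    using min by (auto simp: local_minimizer_def)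
  \<comment> \<open>The line through \<open>z\<close> along \<open>d t\<close> meets the sphere
    again at parameter \<open>r t\<close>, the nonzero root of r (2 t + r (d t \<bullet> d t)) = 0.
    It tends to 0 with t because u \<bullet> u > 0.\<close>
  define d where "d t = u + t *\<^sub>R z" for t
  define r where "r t = - 2 * t / (d t \<bullet> d t)" for t
  define B where "B v = v \<bullet> (Q v + l *\<^sub>R v)" for v
  have dd: "d t \<bullet> d t = u \<bullet> u + t\<^sup>2" and dz: "d t \<bullet> z = t" for t
    using u z by (simp_all add: d_def inner_simps inner_commute power2_eq_square)
  have uu: "0 < u \<bullet> u"
    using False by simp
  have dd_pos: "0 < d t \<bullet> d t" for t
    using uu by (simp add: dd add_pos_nonneg)
  have d_lim: "(d \<longlongrightarrow> u + 0 *\<^sub>R z) (at_right 0)"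
    unfolding d_def by (intro tendsto_intros)
  have "((\<lambda>t. z + r t *\<^sub>R d t) \<longlongrightarrow> z + (- 2 * 0 / (u \<bullet> u + 0\<^sup>2)) *\<^sub>R (u + 0 *\<^sub>R z)) (at_right 0)"
    unfolding r_def dd using uu by (intro tendsto_intros d_lim) simp
  then have "\<forall>\<^sub>F t in at_right 0. dist (z + r t *\<^sub>R d t) z < e"
    using \<open>e > 0\<close> by (simp add: tendsto_iff)
  with eventually_at_right_less[of "0::real"]
  have "\<forall>\<^sub>F t in at_right 0. 0 \<le> B (d t)"
  proof eventually_elim
    case (elim t)
    have rdd: "r t * (d t \<bullet> d t) = - 2 * t"
      using dd_pos[of t] by (simp add: r_def)
    have "(z + r t *\<^sub>R d t) \<bullet> (z + r t *\<^sub>R d t) = 1 + r t * (2 * t + r t * (d t \<bullet> d t))"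
      using z dz[of t] by (simp add: inner_simps inner_commute algebra_simps)
    then have "q z \<le> q (z + r t *\<^sub>R d t)"
      using elim by (intro e) (simp_all add: rdd dist_commute)
    moreover have "(Q z + b) \<bullet> d t = - l * t"
      using stat dz[of t] by (simp add: eq_neg_iff_add_eq_0[symmetric] inner_commute)
    ultimately have "0 \<le> - r t * l * t + (r t)\<^sup>2 / 2 * (d t \<bullet> Q (d t))"
      by (simp add: q_expand_scale)
    \<comment> \<open>Replacing -2 t by r t (d t \<bullet> d t) makes the linear term quadratic in
      \<open>r t\<close>; it supplies the shift by \<open>l\<close> in \<open>B\<close>.\<close>
    also have "- r t * l * t = (r t) / 2 * l * (r t * (d t \<bullet> d t))"
      by (simp only: rdd)
    also have "\<dots> + (r t)\<^sup>2 / 2 * (d t \<bullet> Q (d t)) = (r t)\<^sup>2 / 2 * B (d t)"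
      by (simp add: B_def inner_right_distrib power2_eq_square field_simps)
    finally have "0 \<le> (r t)\<^sup>2 / 2 * B (d t)" .
    moreover have "r t \<noteq> 0"
      using elim dd_pos[of t] by (simp add: r_def)
    ultimately show ?case
      by (simp add: zero_le_mult_iff)
  qed
  moreover have "((\<lambda>t. B (d t)) \<longlongrightarrow> B u) (at_right 0)"
  proof -
    \<comment> \<open>\<open>Q\<close> is known only as a linear self-adjoint map, so the limit is
      read off from a polynomial in t.\<close>
    have "B (d t) = B u + t * (u \<bullet> (Q z + l *\<^sub>R z) + z \<bullet> (Q u + l *\<^sub>R u)) + t\<^sup>2 * B z" for t
      by (simp add: B_def d_def linear_add[OF linear] linear_scale[OF linear] inner_simps
          power2_eq_square algebra_simps)
    moreover have "((\<lambda>t. B u + t * (u \<bullet> (Q z + l *\<^sub>R z) + z \<bullet> (Q u + l *\<^sub>R u)) + t\<^sup>2 * B z) \<longlongrightarrow>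
        B u + 0 * (u \<bullet> (Q z + l *\<^sub>R z) + z \<bullet> (Q u + l *\<^sub>R u)) + 0\<^sup>2 * B z) (at_right 0)"
      by (intro tendsto_intros)
    ultimately show ?thesis
      by simp
  qed
  ultimately have "0 \<le> B u"
    by (intro tendsto_lowerbound) auto
  then show ?thesis
    by (simp add: B_def)
qed simp

end

section \<open>Application to (D)\<close>

lemma shifted_vector_mult: "shifted H l *v u = H *v u + l *\<^sub>R u"
  by (simp add: shifted_def matrix_vector_mult_add_rdistrib scaleR_matrix_vector_assoc[symmetric])

theorem proposition3p3:
  fixes H :: "real^'n^'n" and c :: "real^'n"
  assumes "transpose H = H"
  shows "(\<forall>z. second_order_stationary_point H c z \<longrightarrow>
              global_minimizer (D_objective H c) D_feasible z) \<and>
         (\<forall>z. local_minimizer (D_objective H c) D_feasible z \<longrightarrow>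
              global_minimizer (D_objective H c) D_feasible z)"
proof -
  define Q where "Q = (\<lambda>(x, y). (H *v x, H *v y))"
  \<comment> \<open>Symmetry of \<open>H\<close> enters here and makes \<open>Q\<close>
    self-adjoint.\<close>
  have H: "(H *v x) \<bullet> y = x \<bullet> (H *v y)" for x y
    using assms dot_lmul_matrix[of x H y] vector_transpose_matrix[of x H] by metis
  interpret quadratic_function Q "(c, 0)"
  proof
    show "Q (p + p') = Q p + Q p'" for p p'
      by (simp add: Q_def split_beta matrix_vector_right_distrib)
    show "Q (r *\<^sub>R p) = r *\<^sub>R Q p" for r p
      by (simp add: Q_def split_beta matrix_vector_mult_scaleR)
    show "Q p \<bullet> p' = p \<bullet> Q p'" for p p'
      by (simp add: Q_def split_beta inner_prod_def H)
  qed
  have obj: "D_objective H c = q"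
    unfolding fun_eq_iff q_def by (simp add: D_objective_def Q_def split_beta inner_prod_def)
  have feas: "D_feasible = {w. w \<bullet> w \<le> 1}"
    by (auto simp: D_feasible_def)
  have stationary_point_iff: "stationary_point H c z l \<longleftrightarrow>
      z \<bullet> z \<le> 1 \<and> 0 \<le> l \<and> Q z + (c, 0) + l *\<^sub>R z = 0 \<and> l * (z \<bullet> z - 1) = 0" for z l
    by (cases z) (auto simp: stationary_point_def feas Q_def shifted_vector_mult zero_prod_def
        algebra_simps)
  have sosp_global: "global_minimizer (D_objective H c) D_feasible z"
    if sosp: "second_order_stationary_point H c z" for z
  proof -
    obtain x y where z: "z = (x, y)"
      by fastforce
    obtain l where stat: "stationary_point H c z l"
      and int: "x \<bullet> x + y \<bullet> y < 1 \<Longrightarrow> pos_semidef H"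
      and bd: "\<And>u v. x \<bullet> x + y \<bullet> y = 1 \<Longrightarrow> u \<bullet> x + v \<bullet> y = 0 \<Longrightarrow>
        0 \<le> u \<bullet> (shifted H l *v u) + v \<bullet> (shifted H l *v v)"
      using sosp by (auto simp: second_order_stationary_point_def z)
    have psd: "0 \<le> w \<bullet> (shifted H l *v w)" for w
    proof (cases "x \<bullet> x + y \<bullet> y = 1")
      case True
      show ?thesis
      \<comment> \<open>The factor (w \<bullet> y)^2 + (w \<bullet> x)^2 obtained from the lifted
        vector vanishes only if \<open>w\<close> is orthogonal to both \<open>x\<close> and
        \<open>y\<close>; in that case (w, 0) is itself tangent.\<close>
      proof (cases "w \<bullet> x = 0 \<and> w \<bullet> y = 0")
        case True
        then show ?thesis
          using bd[of w 0] \<open>x \<bullet> x + y \<bullet> y = 1\<close> by simp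
      next
        case False
        have "0 \<le> ((w \<bullet> y)\<^sup>2 + (w \<bullet> x)\<^sup>2) * (w \<bullet> (shifted H l *v w))"
          using bd[of "(w \<bullet> y) *\<^sub>R w" "- (w \<bullet> x) *\<^sub>R w"] True
          by (simp add: matrix_vector_mult_scaleR power2_eq_square algebra_simps
              del: scaleR_minus_left)
        moreover have "0 < (w \<bullet> y)\<^sup>2 + (w \<bullet> x)\<^sup>2"
          using False by (auto simp: sum_power2_gt_zero_iff)
        ultimately show ?thesis
          by (simp add: zero_le_mult_iff)
      qed
    next
      case False
      \<comment> \<open>Off the sphere complementarity forces l = 0, so the shifted matrix is
        \<open>H\<close> itself.\<close>
      then have "x \<bullet> x + y \<bullet> y < 1" "l = 0"
        using stat by (auto simp: stationary_point_iff z)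
      then show ?thesis
        using int by (simp add: shifted_vector_mult pos_semidef_def)
    qed
    have "0 \<le> d \<bullet> (Q d + l *\<^sub>R d)" for d
      using psd[of "fst d"] psd[of "snd d"]
      by (simp add: Q_def split_beta inner_prod_def shifted_vector_mult)
    then show ?thesis
      unfolding obj feas using stat
      by (intro global_minimizer_if_psd[where l = l]) (simp_all add: stationary_point_iff)
  qed
  \<comment> \<open>The second claim reduces to the first once local minimizers are known to be
    second-order stationary.\<close>
  have "second_order_stationary_point H c z"
    if "local_minimizer (D_objective H c) D_feasible z" for z
  proof -
    have min: "local_minimizer q {w. w \<bullet> w \<le> 1} z"
      using that by (simp add: obj feas)
    then have "z \<bullet> z \<le> 1"
      by (simp add: local_minimizer_def)
    obtain x y where z: "z = (x, y)"
      by fastforce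
    show ?thesis
    proof (cases "z \<bullet> z = 1")
      case True
      obtain l where l: "0 \<le> l" "Q z + (c, 0) + l *\<^sub>R z = 0"
        using local_minimizer_sphere_stationary[OF min True] .
      have "stationary_point H c z l"
        using l True by (simp add: stationary_point_iff)
      moreover have "0 \<le> u \<bullet> (shifted H l *v u) + v \<bullet> (shifted H l *v v)"
        if "u \<bullet> x + v \<bullet> y = 0" for u v
        using local_minimizer_sphere_second_order[OF min True l(2), of "(u, v)"] that
        by (simp add: z Q_def shifted_vector_mult)
      ultimately show ?thesis
        using True by (auto simp: second_order_stationary_point_def z)
    next
      case False
      with \<open>z \<bullet> z \<le> 1\<close> have less: "z \<bullet> z < 1"
        by simp
      have "stationary_point H c z 0"
        using less local_minimizer_interior(1)[OF min less] by (simp add: stationary_point_iff)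
      moreover have "pos_semidef H"
        unfolding pos_semidef_def
      proof
        show "0 \<le> u \<bullet> (H *v u)" for u
          using local_minimizer_interior(2)[OF min less, of "(u, 0)"] by (simp add: Q_def)
      qed
      ultimately show ?thesis
        using False by (auto simp: second_order_stationary_point_def z)
    qed
  qed
  with sosp_global show ?thesis
    by blast
qed

end
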